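(* Let $b > a \geq 1$ be integers with $\gcd(a,b)=1$ and $a+b$ odd, and let $\mathrm{N}_{a,b}(x,y)$ denote the minimal number of moves of the $(a,b)$-knight needed to reach $(x,y)\in\mathbb{Z}^2$ from the origin (as defined in the context). Then there is a constant $C>0$ (independent of $a,b,x,y$) such that for all integers $x \geq y \geq 0$: \begin{enumerate} \item[(i)] if $y \leq \frac{a}{b}\,x$, then $\left|\mathrm{N}_{a,b}(x,y) - \frac{x}{b}\right| \leq C b$; \item[(ii)] if $y > \frac{a}{b}\,x$, then $\left|\mathrm{N}_{a,b}(x,y) - \frac{x+y}{a+b}\right| \leq C b$. \end{enumerate} That is, $\mathrm{N}_{a,b}(x,y) = \frac{x}{b} + O(b)$ in case (i) and $\mathrm{N}_{a,b}(x,y) = \frac{x+y}{a+b} + O(b)$ in case (ii).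
   Context: For a finite set $A\subseteq\mathbb{Z}^2$ and $h\geq 1$, let $hA=\{\mathbf{a}_1+\cdots+\mathbf{a}_h : \mathbf{a}_1,\dots,\mathbf{a}_h\in A\}$ be the $h$-fold sumset. Define $A(0,0):=0$ and, for $(x,y)\neq(0,0)$, $A(x,y):=\min\{h\geq 1 : (x,y)\in hA\}$. For integers $a,b\geq 1$, the $(a,b)$-knight is the set $\mathrm{N}_{a,b}=\{(a,b),(b,a),(-a,b),(-b,a),(-b,-a),(-a,-b),(a,-b),(b,-a)\}$; when $\gcd(a,b)=1$ and $a+b$ is odd, $\mathrm{N}_{a,b}(x,y)$ is finite for every $(x,y)\in\mathbb{Z}^2$. *)

theory Defs
  imports "HOL-Library.Product_Plus" "HOL-Library.Extended_Real"
begin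

definition hfold_sumset :: "nat \<Rightarrow> 'a::comm_monoid_add set \<Rightarrow> 'a set" where
  "hfold_sumset h A = {\<Sum>i=1..h. f i | f. \<forall>i\<in>{1..h}. f i \<in> A}"

text \<open>The minimum is taken in \<^typ>\<open>enat\<close>, so that it is \<open>\<infinity>\<close> at a point lying in no
  sumset \<open>hA\<close>.\<close>

definition min_moves :: "(int \<times> int) set \<Rightarrow> int \<Rightarrow> int \<Rightarrow> enat" where
  "min_moves A x y =
     (if (x, y) = (0, 0) then 0
      else Inf {enat h | h. h \<ge> 1 \<and> (x, y) \<in> hfold_sumset h A})"

definition knight :: "int \<Rightarrow> int \<Rightarrow> (int \<times> int) set" where
  "knight a b = {(a, b), (b, a), (- a, b), (- b, a), (- b, - a), (- a, - b), (a, - b), (b, - a)}"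

end

theory Submission
  imports Defs
begin

text \<open>A knight move changes \<open>x\<close> by at most \<open>b\<close> and \<open>x + y\<close> by at most \<open>a + b\<close>; this gives both
  lower bounds without any error. For the upper bounds, write \<open>x = a p + b q\<close> and
  \<open>y = a s + b r\<close> with \<open>p \<equiv> r\<close> and \<open>q \<equiv> s\<close> modulo 2: then \<open>(x, y)\<close> is reached in
  \<open>max \<bar>p\<bar> \<bar>r\<bar> + max \<bar>q\<bar> \<bar>s\<bar>\<close> moves. Since \<open>p\<close> is determined modulo \<open>b\<close> and \<open>r\<close> modulo \<open>a\<close>,
  and since exactly one of \<open>a\<close>, \<open>b\<close> is odd (so that the parities can be adjusted by doubling these
  moduli), \<open>p\<close> and \<open>r\<close> can be taken within \<open>O(b)\<close> of any given real \<open>P\<close>. The choice is \<open>P = 0\<close> in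
  case (i), and in case (ii) the solution of \<open>x = a P + b Q\<close>, \<open>y = b P + a Q\<close>, for which
  \<open>P + Q = (x + y) / (a + b)\<close>.\<close>

section \<open>Sumsets, minimal lengths and points reached by knight moves\<close>

lemma hfold_sumset_0 [simp]: "hfold_sumset 0 A = {0}"
  by (simp add: hfold_sumset_def)

lemma hfold_sumset_Suc_iff:
  "v \<in> hfold_sumset (Suc h) A \<longleftrightarrow> (\<exists>u\<in>hfold_sumset h A. \<exists>w\<in>A. v = u + w)"
proof
  assume "v \<in> hfold_sumset (Suc h) A"
  then obtain f where f: "\<forall>i\<in>{1..Suc h}. f i \<in> A" "v = (\<Sum>i=1..Suc h. f i)"
    by (auto simp: hfold_sumset_def)
  then have "(\<Sum>i=1..h. f i) \<in> hfold_sumset h A" "f (Suc h) \<in> A"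
    by (auto simp: hfold_sumset_def)
  with f(2) show "\<exists>u\<in>hfold_sumset h A. \<exists>w\<in>A. v = u + w"
    by auto
next
  assume "\<exists>u\<in>hfold_sumset h A. \<exists>w\<in>A. v = u + w"
  then obtain f w where f: "\<forall>i\<in>{1..h}. f i \<in> A" "w \<in> A" "v = (\<Sum>i=1..h. f i) + w"
    by (auto simp: hfold_sumset_def)
  define g where "g = f(Suc h := w)"
  have "(\<Sum>i=1..h. g i) = (\<Sum>i=1..h. f i)"
    by (rule sum.cong) (auto simp: g_def)
  with f have "v = (\<Sum>i=1..Suc h. g i)" "\<forall>i\<in>{1..Suc h}. g i \<in> A"
    by (auto simp: g_def)
  then show "v \<in> hfold_sumset (Suc h) A"
    unfolding hfold_sumset_def by blast
qed

lemma hfold_sumset_add: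
  assumes "u \<in> hfold_sumset m A" "v \<in> hfold_sumset n A"
  shows "u + v \<in> hfold_sumset (m + n) A"
  using assms(2)
proof (induction n arbitrary: v)
  case 0
  then show ?case using assms(1) by simp
next
  case (Suc n)
  then show ?case
    by (auto simp: hfold_sumset_Suc_iff) (metis add.assoc)
qed

lemma hfold_sumset_nat_scale:
  fixes A :: "(int \<times> int) set"
  assumes "(s, t) \<in> A"
  shows "(int n * s, int n * t) \<in> hfold_sumset n A"
proof (induction n)
  case 0
  then show ?case by (simp add: zero_prod_def)
next
  case (Suc n)
  have "(int (Suc n) * s, int (Suc n) * t) = (int n * s, int n * t) + (s, t)"
    by (simp add: algebra_simps)
  with Suc assms show ?case
    unfolding hfold_sumset_Suc_iff by blast
qed

lemma hfold_sumset_int_scale: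
  fixes A :: "(int \<times> int) set"
  assumes "(s, t) \<in> A" "(- s, - t) \<in> A"
  shows "(c * s, c * t) \<in> hfold_sumset (nat \<bar>c\<bar>) A"
proof (cases "c \<ge> 0")
  case True
  then show ?thesis
    using hfold_sumset_nat_scale[OF assms(1), of "nat \<bar>c\<bar>"] by simp
next
  case False
  then show ?thesis
    using hfold_sumset_nat_scale[OF assms(2), of "nat \<bar>c\<bar>"] by simp
qed

text \<open>Source of the lower bounds: it is applied with \<open>g\<close> the first coordinate and
  with \<open>g\<close> the sum of the coordinates.\<close>

lemma hfold_sumset_additive_le:
  fixes g :: "'a::comm_monoid_add \<Rightarrow> int"
  assumes "g 0 = 0" and "\<And>u v. g (u + v) = g u + g v" and "\<And>w. w \<in> A \<Longrightarrow> g w \<le> M"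
    and "v \<in> hfold_sumset h A"
  shows "g v \<le> int h * M"
  using assms(4)
proof (induction h arbitrary: v)
  case 0
  then show ?case using assms(1) by simp
next
  case (Suc h)
  then obtain u w where "u \<in> hfold_sumset h A" "w \<in> A" "v = u + w"
    by (auto simp: hfold_sumset_Suc_iff)
  with Suc.IH[of u] assms(2,3) show ?case
    by (fastforce simp: algebra_simps intro: add_mono)
qed

text \<open>Keeping membership for the minimal \<open>n\<close> lets the upper and the lower bounds
  speak of the same \<open>n\<close>. At the origin \<open>n = 0\<close> matches the convention;
  elsewhere \<open>h\<close> is positive, as the 0-fold sumset is \<open>{0}\<close>.\<close>

lemma min_moves_attained:
  assumes "(x, y) \<in> hfold_sumset h A"
  obtains n where "n \<le> h" "min_moves A x y = enat n" "(x, y) \<in> hfold_sumset n A"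
proof (cases "(x, y) = (0, 0)")
  case True
  then show ?thesis
    using that[of 0] by (simp add: min_moves_def zero_prod_def zero_enat_def)
next
  case False
  let ?S = "{enat h | h. h \<ge> 1 \<and> (x, y) \<in> hfold_sumset h A}"
  have "h \<noteq> 0"
    using False assms by (auto simp: zero_prod_def intro!: gr0I)
  then have h: "enat h \<in> ?S"
    using assms by auto
  then have "Inf ?S \<in> ?S"
    by (meson empty_iff wellorder_InfI)
  moreover have "Inf ?S \<le> enat h"
    using h by (rule Inf_lower)
  ultimately show ?thesis
    using False that by (auto simp: min_moves_def)
qed

text \<open>Use \<open>c\<^sub>1\<close>, \<open>c\<^sub>2\<close>, \<open>c\<^sub>3\<close>,
  \<open>c\<^sub>4\<close> signed copies of \<open>(a, b)\<close>, \<open>(b, a)\<close>,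
  \<open>(a, - b)\<close>, \<open>(b, - a)\<close>. Then \<open>p\<close> and \<open>r\<close> are
  the sum and difference of \<open>c\<^sub>1\<close> and \<open>c\<^sub>3\<close>, and
  \<open>q\<close> and \<open>s\<close> those of \<open>c\<^sub>2\<close> and
  \<open>c\<^sub>4\<close>; parity makes these systems solvable in integers. The cost follows from
  |u| + |v| = max(|u + v|, |u - v|).\<close>

lemma knight_reach:
  fixes a b p q r s :: int
  assumes "even (p - r)" "even (q - s)"
  shows "(a * p + b * q, a * s + b * r)
    \<in> hfold_sumset (nat (max \<bar>p\<bar> \<bar>r\<bar> + max \<bar>q\<bar> \<bar>s\<bar>)) (knight a b)"
proof -
  obtain c\<^sub>3 where c3: "p = r + 2 * c\<^sub>3"
    using assms(1) by (metis diff_add_cancel add.commute evenE)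
  obtain c\<^sub>4 where c4: "q = s + 2 * c\<^sub>4"
    using assms(2) by (metis diff_add_cancel add.commute evenE)
  define c\<^sub>1 where "c\<^sub>1 = r + c\<^sub>3"
  define c\<^sub>2 where "c\<^sub>2 = s + c\<^sub>4"
  note defs = c3 c4 c\<^sub>1_def c\<^sub>2_def
  let ?H = "\<lambda>n. hfold_sumset n (knight a b)"
  have "(c\<^sub>1 * a, c\<^sub>1 * b) \<in> ?H (nat \<bar>c\<^sub>1\<bar>)" "(c\<^sub>2 * b, c\<^sub>2 * a) \<in> ?H (nat \<bar>c\<^sub>2\<bar>)"
    "(c\<^sub>3 * a, c\<^sub>3 * - b) \<in> ?H (nat \<bar>c\<^sub>3\<bar>)" "(c\<^sub>4 * b, c\<^sub>4 * - a) \<in> ?H (nat \<bar>c\<^sub>4\<bar>)"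
    by (rule hfold_sumset_int_scale; simp add: knight_def)+
  then have "(c\<^sub>1 * a, c\<^sub>1 * b) + (c\<^sub>2 * b, c\<^sub>2 * a) + (c\<^sub>3 * a, c\<^sub>3 * - b) + (c\<^sub>4 * b, c\<^sub>4 * - a)
      \<in> ?H (nat \<bar>c\<^sub>1\<bar> + nat \<bar>c\<^sub>2\<bar> + nat \<bar>c\<^sub>3\<bar> + nat \<bar>c\<^sub>4\<bar>)"
    by (intro hfold_sumset_add)
  moreover have "(c\<^sub>1 * a, c\<^sub>1 * b) + (c\<^sub>2 * b, c\<^sub>2 * a) + (c\<^sub>3 * a, c\<^sub>3 * - b) + (c\<^sub>4 * b, c\<^sub>4 * - a)
      = (a * p + b * q, a * s + b * r)"
    by (simp add: defs algebra_simps)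
  moreover have maxs: "\<bar>c\<^sub>1\<bar> + \<bar>c\<^sub>3\<bar> = max \<bar>p\<bar> \<bar>r\<bar>" "\<bar>c\<^sub>2\<bar> + \<bar>c\<^sub>4\<bar> = max \<bar>q\<bar> \<bar>s\<bar>"
    unfolding defs by linarith+
  have "nat \<bar>c\<^sub>1\<bar> + nat \<bar>c\<^sub>2\<bar> + nat \<bar>c\<^sub>3\<bar> + nat \<bar>c\<^sub>4\<bar> = nat (max \<bar>p\<bar> \<bar>r\<bar> + max \<bar>q\<bar> \<bar>s\<bar>)"
    by (simp add: nat_add_distrib flip: maxs)
  ultimately show ?thesis
    by simp
qed

section \<open>Linear Diophantine equations with solutions in prescribed windows\<close>

lemma coprime_linear_solution_in_window:
  fixes a b x m :: int
  assumes "coprime a b" "b > 0"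
  obtains p q where "x = a * p + b * q" "m \<le> p" "p < m + b"
proof -
  obtain u v where uv: "a * u + b * v = 1"
    using assms(1) bezout_int[of a b] by (auto simp: mult.commute)
  define k where "k = (u * x - m) div b"
  define p where "p = m + (u * x - m) mod b"
  have p: "p = u * x - b * k"
    unfolding p_def k_def by (simp add: minus_mult_div_eq_mod [symmetric])
  have "a * p + b * (v * x + a * k) = (a * u + b * v) * x"
    by (simp add: p algebra_simps)
  then have "x = a * p + b * (v * x + a * k)"
    by (simp add: uv)
  moreover have "m \<le> p" "p < m + b"
    using assms(2) by (simp_all add: p_def)
  ultimately show ?thesis
    by (rule that)
qed

lemma parity_matched_solutions:
  fixes a b x y m :: int
  assumes "0 < a" "0 < b" "coprime a b" "odd (a + b)"
  obtains p q r s where "x = a * p + b * q" "y = a * s + b * r" "even (p - r)" "even (q - s)"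
    "m \<le> p" "p < m + 2 * b" "m \<le> r" "r < m + 2 * a"
proof -
  obtain p q where pq: "x = a * p + b * q" "m \<le> p" "p < m + b"
    using coprime_linear_solution_in_window[OF assms(3,2)] .
  obtain r s where rs: "y = b * r + a * s" "m \<le> r" "r < m + a"
    using coprime_linear_solution_in_window[of b a y m] assms(1,3) coprime_commute by metis
  have sol: "x = a * (p + b * t) + b * (q - a * t)" "y = a * (s - b * w) + b * (r + a * w)" for t w
    using pq(1) rs(1) by (simp_all add: algebra_simps)
  \<comment> \<open>The two parities can be corrected independently: if \<open>a\<close> is even and
    \<open>b\<close> odd, \<open>t\<close> affects only the first and \<open>w\<close> only the
    second; if \<open>a\<close> is odd and \<open>b\<close> even, the roles are exchanged. One shift
    at most doubles each window.\<close>
  have "\<exists>t w. t \<in> {0, 1} \<and> w \<in> {0, 1} \<and>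
      even ((p + b * t) - (r + a * w)) \<and> even ((q - a * t) - (s - b * w))"
  proof (cases "even a")
    case True
    then show ?thesis
      using assms(4)
      by (intro exI[of _ "(p - r) mod 2"] exI[of _ "(q - s) mod 2"]) (auto simp: mod_2_eq_odd)
  next
    case False
    then show ?thesis
      using assms(4)
      by (intro exI[of _ "(q - s) mod 2"] exI[of _ "(p - r) mod 2"]) (auto simp: mod_2_eq_odd)
  qed
  then obtain t w where tw: "t \<in> {0, 1}" "w \<in> {0, 1}"
    and even: "even ((p + b * t) - (r + a * w))" "even ((q - a * t) - (s - b * w))"
    by blast
  have "m \<le> p + b * t" "p + b * t < m + 2 * b" "m \<le> r + a * w" "r + a * w < m + 2 * a"
    using tw pq(2,3) rs(2,3) assms(1,2) by auto
  with that[OF sol even] show ?thesis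
    by blast
qed

section \<open>Bounds on the number of moves\<close>

lemma abs_bound_of_mult_bounds:
  fixes c q t e :: real
  assumes "0 < c" "c * q \<le> c * t" "- c * e \<le> c * q" "0 \<le> t" "0 \<le> e"
  shows "\<bar>q\<bar> \<le> t + e"
proof -
  have "q \<le> t"
    using assms(1,2) by simp
  moreover have "c * (- e) \<le> c * q"
    using assms(3) by simp
  then have "- e \<le> q"
    using assms(1) by (simp only: mult_le_cancel_left_pos)
  ultimately show ?thesis
    using assms(4,5) by linarith
qed

text \<open>Inequalities on \<open>x\<close> and \<open>y\<close> instead of equations let one
  statement serve both cases of the theorem. Each of the two maxima in the cost exceeds
  \<open>P\<close> or \<open>Q\<close> by at most \<open>3 * b\<close>, whence the constant
  6.\<close>

lemma knight_moves_upper: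
  fixes a b x y :: int and P Q :: real
  assumes ab: "1 \<le> a" "a < b" "gcd a b = 1" "odd (a + b)"
    and PQ: "0 \<le> P" "0 \<le> Q"
    and x: "a * P \<le> x" "x \<le> a * P + b * Q"
    and y: "b * P \<le> y" "y \<le> b * P + a * Q"
  obtains n where "min_moves (knight a b) x y = enat n" "(x, y) \<in> hfold_sumset n (knight a b)"
    "real n \<le> P + Q + 6 * b"
proof -
  \<comment> \<open>Starting the windows at or above \<open>P\<close> gives
    \<open>p, r \<ge> P\<close>, which forces \<open>q, s \<le> Q\<close>; it remains to see that
    \<open>q\<close> and \<open>s\<close> are not too negative.\<close>
  define m where "m = \<lceil>P\<rceil>"
  have m: "P \<le> m" "m < P + 1" "0 \<le> m"
    using PQ(1) ceiling_correct[of P] by (simp_all add: m_def)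
  have "0 < a" "0 < b" "coprime a b"
    using ab by (simp_all add: coprime_iff_gcd_eq_1)
  then obtain p q r s where sol: "x = a * p + b * q" "y = a * s + b * r"
    and even: "even (p - r)" "even (q - s)"
    and p: "m \<le> p" "p < m + 2 * b" and r: "m \<le> r" "r < m + 2 * a"
    using ab(4) by (rule parity_matched_solutions)
  define h where "h = max \<bar>p\<bar> \<bar>r\<bar> + max \<bar>q\<bar> \<bar>s\<bar>"
  have ab': "1 \<le> real_of_int a" "real_of_int a \<le> b" "1 \<le> real_of_int b"
    using ab by auto
  have p': "P \<le> p" "p \<le> P + (1 + 2 * b)" and r': "P \<le> r" "r \<le> P + (1 + 2 * a)"
    using m p r by linarith+
  have xq: "b * real_of_int q = x - a * real_of_int p" and ys: "a * real_of_int s = y - b * real_of_int r"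
    by (simp_all add: sol)
  have "\<bar>real_of_int q\<bar> \<le> Q + 3 * real_of_int b"
  proof (rule abs_bound_of_mult_bounds[of b])
    have "a * P \<le> a * real_of_int p"
      using p' ab' by (intro mult_left_mono) auto
    then show "b * real_of_int q \<le> b * Q"
      using x xq by linarith
    have "a * real_of_int p \<le> a * P + a * real_of_int (1 + 2 * b)"
      using mult_left_mono[OF p'(2), of a] ab' by (simp add: distrib_left)
    also have "a * real_of_int (1 + 2 * b) \<le> b * (3 * real_of_int b)"
      using ab' by (intro mult_mono) auto
    finally show "- real_of_int b * (3 * real_of_int b) \<le> b * real_of_int q"
      using x xq by simp
  qed (use PQ ab' in auto)
  moreover have "\<bar>real_of_int s\<bar> \<le> Q + 3 * real_of_int b"
  proof (rule abs_bound_of_mult_bounds[of a])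
    have "b * P \<le> b * real_of_int r"
      using r' ab' by (intro mult_left_mono) auto
    then show "a * real_of_int s \<le> a * Q"
      using y ys by linarith
    \<comment> \<open>The window of \<open>r\<close> has length \<open>2 * a\<close>, not
      \<open>2 * b\<close>: the excess \<open>b * (1 + 2 * a)\<close> is divided by the possibly
      small \<open>a\<close> and must still be \<open>O(b)\<close>.\<close>
    have "b * real_of_int r \<le> b * P + b * real_of_int (1 + 2 * a)"
      using mult_left_mono[OF r'(2), of b] ab' by (simp add: distrib_left)
    also have "b * real_of_int (1 + 2 * a) \<le> b * (3 * real_of_int a)"
      using ab' by (intro mult_left_mono) auto
    finally show "- real_of_int a * (3 * real_of_int b) \<le> a * real_of_int s"
      using y ys by (simp add: algebra_simps)
  qed (use PQ ab' in auto)
  moreover have "\<bar>real_of_int p\<bar> \<le> P + 3 * real_of_int b" "\<bar>real_of_int r\<bar> \<le> P + 3 * real_of_int b"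
    using p' r' ab' PQ by linarith+
  ultimately have "real_of_int (max \<bar>p\<bar> \<bar>r\<bar>) \<le> P + 3 * real_of_int b"
    "real_of_int (max \<bar>q\<bar> \<bar>s\<bar>) \<le> Q + 3 * real_of_int b"
    by (simp_all add: of_int_max)
  then have "real_of_int h \<le> P + Q + 6 * b"
    unfolding h_def of_int_add of_int_mult of_int_numeral by linarith
  moreover have "0 \<le> h"
    by (simp add: h_def le_max_iff_disj)
  have "(x, y) \<in> hfold_sumset (nat h) (knight a b)"
    unfolding h_def sol using even by (rule knight_reach)
  then obtain n where n: "n \<le> nat h" "min_moves (knight a b) x y = enat n"
    "(x, y) \<in> hfold_sumset n (knight a b)"
    by (rule min_moves_attained)
  moreover have "real n \<le> h"
    using n(1) \<open>0 \<le> h\<close> by linarith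
  ultimately show ?thesis
    using n(2,3) by (intro that[of n]) auto
qed

lemma knight_moves_lower:
  fixes a b x y :: int
  assumes "0 < a" "a < b" "(x, y) \<in> hfold_sumset n (knight a b)"
  shows "x / b \<le> real n" "(x + y) / (a + b) \<le> real n"
proof -
  have "fst (x, y) \<le> int n * b"
    by (rule hfold_sumset_additive_le[OF _ _ _ assms(3)]) (use assms in \<open>auto simp: knight_def\<close>)
  then have "real_of_int x \<le> real n * b"
    by (metis fst_conv of_int_le_iff of_int_mult of_int_of_nat_eq)
  then show "x / b \<le> real n"
    using assms by (simp add: pos_divide_le_eq)
  have "(\<lambda>v. fst v + snd v) (x, y) \<le> int n * (a + b)"
    by (rule hfold_sumset_additive_le[OF _ _ _ assms(3)]) (use assms in \<open>auto simp: knight_def\<close>)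
  then have "real_of_int (x + y) \<le> real n * real_of_int (a + b)"
    by (metis fst_conv snd_conv of_int_le_iff of_int_mult of_int_of_nat_eq)
  then show "(x + y) / (a + b) \<le> real n"
    using assms by (simp add: pos_divide_le_eq)
qed

theorem theorem1p1:
  shows "\<exists>C::real. C > 0 \<and>
    (\<forall>a b :: int. 1 \<le> a \<and> a < b \<and> gcd a b = 1 \<and> odd (a + b) \<longrightarrow>
      (\<forall>x y :: int. x \<ge> y \<and> y \<ge> 0 \<longrightarrow>
        (real_of_int y \<le> real_of_int a / real_of_int b * real_of_int x \<longrightarrow>
          \<bar>ereal_of_enat (min_moves (knight a b) x y)
             - ereal (real_of_int x / real_of_int b)\<bar> \<le> ereal (C * real_of_int b)) \<and>
        (real_of_int y > real_of_int a / real_of_int b * real_of_int x \<longrightarrow>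
          \<bar>ereal_of_enat (min_moves (knight a b) x y)
             - ereal (real_of_int (x + y) / real_of_int (a + b))\<bar> \<le> ereal (C * real_of_int b))))"
proof (intro exI[of _ 6] conjI allI impI)
  fix a b x y :: int
  assume "1 \<le> a \<and> a < b \<and> gcd a b = 1 \<and> odd (a + b)" and "x \<ge> y \<and> y \<ge> 0"
  then have ab: "1 \<le> a" "a < b" "gcd a b = 1" "odd (a + b)" and xy: "y \<le> x" "0 \<le> y"
    by auto
  have pos: "0 < real_of_int a" "0 < real_of_int b" "real_of_int a < real_of_int b"
    and xy': "real_of_int y \<le> x" "0 \<le> real_of_int y"
    using ab xy by auto
  note lower = knight_moves_lower[of a b x y]
  {
    assume "real_of_int y \<le> real_of_int a / real_of_int b * real_of_int x"
    \<comment> \<open>With \<open>P = 0\<close> and \<open>Q = x / b\<close>, the case assumption is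
      exactly the bound \<open>y \<le> b * P + a * Q\<close>.\<close>
    then obtain n where "min_moves (knight a b) x y = enat n"
      "(x, y) \<in> hfold_sumset n (knight a b)" "real n \<le> 0 + x / b + 6 * b"
      using knight_moves_upper[of a b 0 "x / b" x y] ab xy pos by auto
    with lower ab show "\<bar>ereal_of_enat (min_moves (knight a b) x y)
      - ereal (real_of_int x / real_of_int b)\<bar> \<le> ereal (6 * real_of_int b)"
      by simp
  next
    assume above: "real_of_int y > real_of_int a / real_of_int b * real_of_int x"
    \<comment> \<open>Cramer's rule for \<open>a * P + b * Q = x\<close>,
      \<open>b * P + a * Q = y\<close>, with the sign of the determinant reversed so that
      \<open>D > 0\<close>. The case assumption gives \<open>P \<ge> 0\<close>; \<open>a < b\<close>
      and \<open>y \<le> x\<close> give \<open>Q \<ge> 0\<close>.\<close>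
    define D where "D = real_of_int b ^ 2 - real_of_int a ^ 2"
    define P where "P = (b * y - a * x) / D"
    define Q where "Q = (b * x - a * y) / D"
    have D: "D = (b - a) * (real_of_int a + b)"
      by (simp add: D_def power2_eq_square algebra_simps)
    then have "D > 0"
      using pos by simp
    have P0: "0 \<le> P"
      unfolding P_def using above pos \<open>D > 0\<close> by (simp add: field_simps)
    have "real_of_int a * y \<le> b * real_of_int x"
      using pos xy' by (intro mult_mono) auto
    then have Q0: "0 \<le> Q"
      unfolding Q_def using \<open>D > 0\<close> by simp
    have "a * P + b * Q = x * D / D" "b * P + a * Q = y * D / D" "P + Q = (b - a) * (x + y) / D"
      unfolding P_def Q_def times_divide_eq_right add_divide_distrib[symmetric]
      by (rule arg_cong2[of _ _ _ _ "(/)"]; simp add: D_def power2_eq_square algebra_simps)+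
    then have PQ: "a * P + b * Q = x" "b * P + a * Q = y" "P + Q = (x + y) / (a + b)"
      using \<open>D > 0\<close> D pos by simp_all
    have "0 \<le> a * Q" "0 \<le> b * Q"
      using Q0 pos by simp_all
    then have "a * P \<le> x" "b * P \<le> y"
      using PQ by linarith+
    then obtain n where "min_moves (knight a b) x y = enat n"
      "(x, y) \<in> hfold_sumset n (knight a b)" "real n \<le> P + Q + 6 * b"
      using knight_moves_upper[of a b P Q x y] ab P0 Q0 PQ by auto
    with lower ab PQ(3) show "\<bar>ereal_of_enat (min_moves (knight a b) x y)
      - ereal (real_of_int (x + y) / real_of_int (a + b))\<bar> \<le> ereal (6 * real_of_int b)"
      by simp
  }
qed simp

end
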